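(* Let $R:\mathbb{R}^n\to\mathbb{R}\cup\{+\infty\}$ be proper, convex and lower semicontinuous, let $F:\mathbb{R}^n\to\mathbb{R}$ be convex and differentiable with $\frac1\beta$-Lipschitz continuous gradient ($\beta>0$), put $\Phi=F+R$ and assume $\mathrm{Argmin}(\Phi)\neq\emptyset$. Let $(x_k)_{k\in\mathbb{N}}$ be generated by the inexact inertial Forward--Backward iteration (described in the context) with errors $\varepsilon_k\ge0$ and $\xi_k\in\mathbb{R}^n$. Suppose that $\bar a<1$, that $$\sum_{k\in\mathbb{N}}\max\{a_k,b_k\}\,\|x_k-x_{k-1}\|^2<+\infty,$$ and moreover that one of the following holds: (i) $a_k\in]0,\bar a]$ for all $k$, $\sum_{k\in\mathbb{N}}\varepsilon_k<+\infty$ and $\sum_{k\in\mathbb{N}}k\|\xi_k\|<+\infty$; (ii) $a_k\equiv0$, $\sum_{k\in\mathbb{N}}\varepsilon_k<+\infty$ and $\sum_{k\in\mathbb{N}}\|\xi_k\|<+\infty$. Then there exists $x^\star\in\mathrm{Argmin}(\Phi)$ such that $(x_k)_{k\in\mathbb{N}}$ converges to $x^\star$.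
   Context: For a maximal monotone operator $A:\mathbb{R}^n\rightrightarrows\mathbb{R}^n$ and $\varepsilon\ge0$, the $\varepsilon$-enlargement of $A$ is $A^\varepsilon(x)=\{v\in\mathbb{R}^n:\langle u-v,y-x\rangle\ge-\varepsilon,\ \forall y\in\mathbb{R}^n,\ \forall u\in A(y)\}$. $\partial^\varepsilon R$ denotes the $\varepsilon$-enlargement of the subdifferential $\partial R$. Inexact inertial Forward--Backward iteration: fix $\bar a\le 1$, $\bar b\le 1$, $\underline\epsilon,\bar\epsilon>0$ with $\underline\epsilon\le 2\beta-\bar\epsilon$, $x_0\in\mathbb{R}^n$, $x_{-1}=x_0$. For each $k\in\mathbb{N}$ choose $a_k\in[0,\bar a]$, $b_k\in[0,\bar b]$, $\gamma_k\in[\underline\epsilon,2\beta-\bar\epsilon]$, set $y_{a,k}=x_k+a_k(x_k-x_{k-1})$, $y_{b,k}=x_k+b_k(x_k-x_{k-1})$, and let $x_{k+1}$ be any point such that $$y_{a,k}-\gamma_k\big(\nabla F(y_{b,k})+\xi_k\big)-x_{k+1}\in\gamma_k\,\partial^{\varepsilon_k}R(x_{k+1}).$$ *)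

theory Defs
  imports "HOL-Analysis.Analysis"
begin

text \<open>
  Extended-real-valued functions take values in \<^typ>\<open>ereal\<close>; the value \<open>-\<infinity>\<close> is excluded by
  properness. In \<open>convex_ereal\<close> the convention \<open>0 * \<infinity> = 0\<close> of \<^typ>\<open>ereal\<close> applies, so the
  degenerate cases \<open>u = 0\<close> and \<open>v = 0\<close> hold trivially.
\<close>

definition proper_ereal :: "('a \<Rightarrow> ereal) \<Rightarrow> bool" where
  "proper_ereal f \<longleftrightarrow> (\<forall>x. f x \<noteq> - \<infinity>) \<and> (\<exists>x. f x \<noteq> \<infinity>)"

definition convex_ereal :: "('a::real_vector \<Rightarrow> ereal) \<Rightarrow> bool" where
  "convex_ereal f \<longleftrightarrow>
     (\<forall>x y. \<forall>u\<ge>0. \<forall>v\<ge>0. u + v = 1 \<longrightarrow>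
        f (u *\<^sub>R x + v *\<^sub>R y) \<le> ereal u * f x + ereal v * f y)"

definition lower_semicontinuous :: "('a::topological_space \<Rightarrow> ereal) \<Rightarrow> bool" where
  "lower_semicontinuous f \<longleftrightarrow> (\<forall>x. f x \<le> Liminf (at x) f)"

definition Argmin :: "('a \<Rightarrow> ereal) \<Rightarrow> 'a set" where
  "Argmin f = {x. \<forall>y. f x \<le> f y}"

definition subdifferential :: "('a::real_inner \<Rightarrow> ereal) \<Rightarrow> 'a \<Rightarrow> 'a set" where
  "subdifferential f x = {v. \<forall>y. f x + ereal (v \<bullet> (y - x)) \<le> f y}"

text \<open>
  The enlargement is defined for every set-valued operator; here it is applied to the
  subdifferential of a proper, convex, lower semicontinuous function, which is maximal monotone.
\<close>

definition enlargement :: "('a::real_inner \<Rightarrow> 'a set) \<Rightarrow> real \<Rightarrow> 'a \<Rightarrow> 'a set" where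
  "enlargement A e x = {v. \<forall>y. \<forall>u\<in>A y. (u - v) \<bullet> (y - x) \<ge> - e}"

text \<open>\<open>prev x k\<close> is $x_{k-1}$, with the convention $x_{-1} = x_0$.\<close>

definition prev :: "(nat \<Rightarrow> 'a) \<Rightarrow> nat \<Rightarrow> 'a" where
  "prev x k = (case k of 0 \<Rightarrow> x 0 | Suc j \<Rightarrow> x j)"

definition extrapolate :: "(nat \<Rightarrow> 'a::real_vector) \<Rightarrow> (nat \<Rightarrow> real) \<Rightarrow> nat \<Rightarrow> 'a" where
  "extrapolate x c k = x k + c k *\<^sub>R (x k - prev x k)"

text \<open>
  The iteration for a smooth part with gradient \<open>G\<close> and a nonsmooth part \<open>R\<close>. The bounds
  \<open>a_up\<close>, \<open>b_up\<close>, \<open>\<epsilon>_low\<close>, \<open>\<epsilon>_up\<close> are $\bar a$, $\bar b$, $\underline\epsilon$,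
  $\bar\epsilon$; \<open>err\<close> is the sequence $\varepsilon_k$ of enlargement parameters.
\<close>

definition inexact_inertial_FB ::
  "real \<Rightarrow> ('a::real_inner \<Rightarrow> 'a) \<Rightarrow> ('a \<Rightarrow> ereal) \<Rightarrow> real \<Rightarrow> real \<Rightarrow> real \<Rightarrow> real \<Rightarrow>
   (nat \<Rightarrow> real) \<Rightarrow> (nat \<Rightarrow> real) \<Rightarrow> (nat \<Rightarrow> real) \<Rightarrow> (nat \<Rightarrow> real) \<Rightarrow> (nat \<Rightarrow> 'a) \<Rightarrow>
   (nat \<Rightarrow> 'a) \<Rightarrow> bool" where
  "inexact_inertial_FB \<beta> G R a_up b_up \<epsilon>_low \<epsilon>_up a b \<gamma> err \<xi> x \<longleftrightarrow>
     a_up \<le> 1 \<and> b_up \<le> 1 \<and> \<epsilon>_low > 0 \<and> \<epsilon>_up > 0 \<and> \<epsilon>_low \<le> 2 * \<beta> - \<epsilon>_up \<and>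
     (\<forall>k. a k \<in> {0..a_up} \<and> b k \<in> {0..b_up} \<and> \<gamma> k \<in> {\<epsilon>_low..2 * \<beta> - \<epsilon>_up} \<and> err k \<ge> 0 \<and>
          extrapolate x a k - \<gamma> k *\<^sub>R (G (extrapolate x b k) + \<xi> k) - x (Suc k)
            \<in> (\<lambda>v. \<gamma> k *\<^sub>R v) ` enlargement (subdifferential R) (err k) (x (Suc k)))"

end

theory Submission
  imports Defs
begin

text \<open>
  Testing the enlargement inclusion against \<open>- G z \<in> \<partial>R(z)\<close> for a minimiser \<open>z\<close>, and using the
  cocoercivity of \<open>G\<close>, shows that \<open>\<parallel>x\<^sub>k - z\<parallel>\<^sup>2\<close> satisfies an inertial quasi-Fejer inequality: its
  increments are at most \<open>a\<^sub>k\<close> times the previous increment plus summable terms, minus a multiple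
  of \<open>\<parallel>x\<^sub>k\<^sub>+\<^sub>1 - y\<^sub>a\<^sub>,\<^sub>k\<parallel>\<^sup>2\<close>. The error term \<open>\<parallel>\<xi>\<^sub>k\<parallel> \<parallel>x\<^sub>k\<^sub>+\<^sub>1 - z\<parallel>\<close> contains the unknown distance, but comparing
  partial sums with the running maximum of the distances gives boundedness from
  \<open>\<Sum>\<parallel>\<xi>\<^sub>k\<parallel> < \<infinity>\<close> alone, so both cases are treated at once. Hence \<open>\<parallel>x\<^sub>k - z\<parallel>\<close> converges for
  every minimiser \<open>z\<close>, and \<open>x\<^sub>k\<^sub>+\<^sub>1 - y\<^sub>a\<^sub>,\<^sub>k\<close> tends to \<open>0\<close>. Maximal monotonicity of \<open>\<partial>R\<close> makes every
  cluster point a minimiser, and Opial's argument concludes.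
\<close>

section \<open>Fermat's rule and gradients of convex functions\<close>

lemma GDERIV_along_line:
  fixes f :: "'a::real_inner \<Rightarrow> real"
  assumes "GDERIV f (p + t *\<^sub>R d) :> g"
  shows "((\<lambda>t. f (p + t *\<^sub>R d)) has_real_derivative d \<bullet> g) (at t)"
proof -
  have "((\<lambda>t. p + t *\<^sub>R d) has_derivative (\<lambda>h. h *\<^sub>R d)) (at t)"
    by (auto intro!: derivative_eq_intros)
  then have "((\<lambda>t. f (p + t *\<^sub>R d)) has_derivative (\<lambda>h. (h *\<^sub>R d) \<bullet> g)) (at t)"
    using assms unfolding gderiv_def by (rule has_derivative_compose)
  then show ?thesis
    by (simp add: has_field_derivative_def mult.commute[of _ "d \<bullet> g"])
qed

text \<open>Moving from \<open>p\<close> a fraction \<open>t\<close> towards \<open>y\<close>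
  changes \<open>R\<close> by at most \<open>t * (s - r)\<close> by convexity, so minimality bounds
  the difference quotient of \<open>f\<close> below by \<open>r - s\<close>; then \<open>t\<close>
  tends to \<open>0\<close> from the right. Only \<open>R\<close> has to be convex, which allows a
  concave \<open>f\<close> later on.\<close>

lemma Fermat_rule_subdifferential:
  fixes f :: "'a::real_inner \<Rightarrow> real" and R :: "'a \<Rightarrow> ereal"
  assumes R: "convex_ereal R" "R p \<noteq> \<infinity>" "R p \<noteq> -\<infinity>"
    and f: "GDERIV f p :> g"
    and min: "\<And>y. ereal (f p) + R p \<le> ereal (f y) + R y"
  shows "- g \<in> subdifferential R p"
proof -
  obtain r where r: "R p = ereal r" using R by (cases "R p") auto
  have "R p + ereal (- g \<bullet> (y - p)) \<le> R y" for y
  proof (cases "R y")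
    case (real s)
    define d where "d = y - p"
    have "((\<lambda>t. f (p + t *\<^sub>R d)) has_real_derivative d \<bullet> g) (at 0)"
      using f by (intro GDERIV_along_line) simp
    then have "((\<lambda>t. (f (p + t *\<^sub>R d) - f p) / t) \<longlongrightarrow> d \<bullet> g) (at_right 0)"
      by (auto simp: DERIV_def intro: filterlim_mono[OF _ order_refl at_within_le_at])
    moreover have "eventually (\<lambda>t. (f (p + t *\<^sub>R d) - f p) / t \<ge> r - s) (at_right 0)"
      using eventually_at_right_real[of 0 "1::real", OF zero_less_one]
    proof eventually_elim
      case (elim t)
      then have t: "0 < t" "t < 1" by auto
      have eq: "(1 - t) *\<^sub>R p + t *\<^sub>R y = p + t *\<^sub>R d"
        by (simp add: d_def algebra_simps)
      have "R (p + t *\<^sub>R d) \<le> ereal (1 - t) * R p + ereal t * R y"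
        using R(1) t unfolding convex_ereal_def eq[symmetric] by auto
      then have "ereal (f p) + R p \<le> ereal (f (p + t *\<^sub>R d)) + (ereal (1 - t) * R p + ereal t * R y)"
        using min[of "p + t *\<^sub>R d"] by (meson add_left_mono order_trans)
      then have "t * (r - s) \<le> f (p + t *\<^sub>R d) - f p"
        using r real by (simp add: algebra_simps)
      then show ?case using t by (simp add: field_simps)
    qed
    ultimately have "r - s \<le> d \<bullet> g"
      by (intro tendsto_lowerbound) auto
    then show ?thesis using r real by (simp add: d_def inner_commute algebra_simps)
  next
    case PInf
    then show ?thesis by simp
  next
    case MInf
    then show ?thesis using min[of y] r by simp
  qed
  then show ?thesis by (simp add: subdifferential_def)
qed

lemma convex_ereal_of_convex_on:
  "convex_on UNIV F \<Longrightarrow> convex_ereal (\<lambda>z. ereal (F z))"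
  by (auto simp: convex_ereal_def convex_on_def)

text \<open>The sum of \<open>- F\<close> and \<open>F\<close> is constant, hence minimal
  everywhere. Fermat's rule with smooth part \<open>- F\<close> and nonsmooth part \<open>F\<close>
  turns the gradient into a subgradient.\<close>

lemma convex_gradient_ineq:
  fixes F :: "'a::real_inner \<Rightarrow> real"
  assumes "convex_on UNIV F" and G: "GDERIV F z :> g"
  shows "F z + g \<bullet> (y - z) \<le> F y"
proof -
  have "GDERIV (\<lambda>y. - F y) z :> - g" using G by (rule GDERIV_minus)
  then have "- (- g) \<in> subdifferential (\<lambda>z. ereal (F z)) z"
    by (intro Fermat_rule_subdifferential[where f = "\<lambda>y. - F y"])
       (auto intro: convex_ereal_of_convex_on assms)
  then show ?thesis by (auto simp: subdifferential_def)
qed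

section \<open>Lipschitz gradients and cocoercivity\<close>

text \<open>Along the segment from \<open>x\<close> to \<open>y\<close>, \<open>F\<close> minus its
  quadratic model has nonpositive derivative by Cauchy-Schwarz and the Lipschitz bound, so it does
  not increase.\<close>

lemma descent_lemma:
  fixes F :: "'a::real_inner \<Rightarrow> real"
  assumes G: "\<And>z. GDERIV F z :> G z" and lip: "L-lipschitz_on UNIV G"
  shows "F y \<le> F x + G x \<bullet> (y - x) + L / 2 * (norm (y - x))\<^sup>2"
proof -
  define d where "d = y - x"
  define g where "g t = F (x + t *\<^sub>R d) - t * (G x \<bullet> d) - L / 2 * t\<^sup>2 * (norm d)\<^sup>2" for t :: real
  have "g 1 \<le> g 0"
  proof (rule DERIV_nonpos_imp_nonincreasing[of 0 1 g])
    fix t :: real assume t: "0 \<le> t" "t \<le> 1"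
    have "(g has_real_derivative d \<bullet> G (x + t *\<^sub>R d) - G x \<bullet> d - L * t * (norm d)\<^sup>2) (at t)"
      unfolding g_def by (rule derivative_eq_intros GDERIV_along_line G refl | simp)+
    moreover have "d \<bullet> G (x + t *\<^sub>R d) - G x \<bullet> d - L * t * (norm d)\<^sup>2 \<le> 0"
    proof -
      have "d \<bullet> G (x + t *\<^sub>R d) - G x \<bullet> d = d \<bullet> (G (x + t *\<^sub>R d) - G x)"
        by (simp add: inner_diff_right inner_commute)
      also have "\<dots> \<le> norm d * norm (G (x + t *\<^sub>R d) - G x)"
        by (rule norm_cauchy_schwarz)
      also have "\<dots> \<le> norm d * (L * norm (t *\<^sub>R d))"
        using lipschitz_onD[OF lip, of "x + t *\<^sub>R d" x]
        by (intro mult_left_mono) (auto simp: dist_norm)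
      also have "\<dots> = L * t * (norm d)\<^sup>2" using t by (simp add: power2_eq_square)
      finally show ?thesis by simp
    qed
    ultimately show "\<exists>y. (g has_real_derivative y) (at t) \<and> y \<le> 0" by blast
  qed simp
  then show ?thesis by (simp add: g_def d_def)
qed

lemma Baillon_Haddad:
  fixes F :: "'a::real_inner \<Rightarrow> real"
  assumes "\<beta> > 0" and conv: "convex_on UNIV F" and G: "\<And>z. GDERIV F z :> G z"
    and lip: "(1 / \<beta>)-lipschitz_on UNIV G"
  shows "\<beta> * (norm (G x - G y))\<^sup>2 \<le> (G x - G y) \<bullet> (x - y)"
proof -
  have half: "\<beta> / 2 * (norm (G y - G x))\<^sup>2 \<le> F y - F x - G x \<bullet> (y - x)" for x y
  proof -
    \<comment> \<open>One gradient step from \<open>y\<close> for \<open>F - G x \<bullet> _\<close>, which is minimal at \<open>x\<close>.\<close>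
    define d where "d = G y - G x"
    define w where "w = y - \<beta> *\<^sub>R d"
    have "F x + G x \<bullet> (w - x) \<le> F w" by (rule convex_gradient_ineq[OF conv G])
    also have "F w \<le> F y + G y \<bullet> (w - y) + (1 / \<beta>) / 2 * (norm (w - y))\<^sup>2"
      by (rule descent_lemma[OF G lip])
    finally have "F x + G x \<bullet> (y - x) - \<beta> * (G x \<bullet> d) \<le> F y - \<beta> * (G y \<bullet> d) + \<beta> / 2 * (d \<bullet> d)"
      using \<open>\<beta> > 0\<close>
      by (simp add: w_def power_mult_distrib power2_norm_eq_inner[symmetric] inner_diff_right
          algebra_simps power2_eq_square)
    moreover have "d \<bullet> d = G y \<bullet> d - G x \<bullet> d" by (simp add: d_def inner_diff_left)
    then have "\<beta> * (d \<bullet> d) = \<beta> * (G y \<bullet> d) - \<beta> * (G x \<bullet> d)"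
      by (simp only: right_diff_distrib)
    ultimately show ?thesis unfolding power2_norm_eq_inner d_def[symmetric] by linarith
  qed
  \<comment> \<open>Adding \<open>half\<close> for both orders of the two points cancels the values
    of \<open>F\<close>, and the two halves of \<beta> add up.\<close>
  have "(G x - G y) \<bullet> (x - y) = - (G x \<bullet> (y - x)) - G y \<bullet> (x - y)"
    by (simp add: inner_diff_left inner_diff_right)
  then show ?thesis using half[of y x] half[of x y] by (simp add: norm_minus_commute)
qed

section \<open>Lower semicontinuity and existence of minimisers\<close>

text \<open>The definition uses the punctured filter \<open>at p\<close>; including \<open>p\<close>
  itself yields the open neighbourhoods that a covering argument needs.\<close>

lemma lower_semicontinuous_eventually:
  assumes "lower_semicontinuous f" "c < f p"
  shows "eventually (\<lambda>y. c < f y) (nhds p)"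
proof -
  have "eventually (\<lambda>y. c < f y) (at p)"
    using assms unfolding lower_semicontinuous_def by (metis le_Liminf_iff)
  then show ?thesis using assms(2) unfolding eventually_at_filter
    by (auto elim!: eventually_mono)
qed

lemma lower_semicontinuous_add_real:
  fixes R :: "'a::topological_space \<Rightarrow> ereal"
  assumes R: "lower_semicontinuous R" "\<And>x. R x \<noteq> -\<infinity>" and q: "continuous_on UNIV q"
  shows "lower_semicontinuous (\<lambda>y. ereal (q y) + R y)"
  unfolding lower_semicontinuous_def le_Liminf_iff
proof (intro allI impI)
  fix p c assume c: "c < ereal (q p) + R p"
  show "eventually (\<lambda>y. c < ereal (q y) + R y) (at p)"
  proof (cases c)
    case (real c')
    have "ereal (c' - q p) < R p" using c real by (cases "R p") auto
    \<comment> \<open>The level \<open>t\<close> splits the strict inequality into two open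
      conditions: \<open>R y > t\<close> by semicontinuity and \<open>q y > c' - t\<close> by
      continuity.\<close>
    then obtain t where t: "ereal (c' - q p) < ereal t" "ereal t < R p"
      using ereal_dense2 by blast
    have "eventually (\<lambda>y. ereal t < R y) (at p)"
      using lower_semicontinuous_eventually[OF R(1) t(2)]
      by (auto simp: eventually_at_filter elim: eventually_mono)
    moreover have "(q \<longlongrightarrow> q p) (at p)"
      using q by (simp add: continuous_on_def)
    then have "eventually (\<lambda>y. c' - t < q y) (at p)"
      using t(1) by (intro order_tendstoD) auto
    ultimately show ?thesis
    proof eventually_elim
      case (elim y)
      then show ?case using real by (cases "R y") auto
    qed
  next
    case PInf
    then show ?thesis using c by simp
  next
    case MInf
    have "- \<infinity> < ereal (q y) + R y" for y using R(2)[of y] by (cases "R y") auto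
    then show ?thesis using MInf by simp
  qed
qed

text \<open>Without a minimiser each \<open>p\<close> has a strictly better \<open>q p\<close>, and
  the neighbourhoods where \<open>h\<close> exceeds \<open>h (q p)\<close> cover \<open>K\<close>.
  In a finite subcover the best \<open>q p0\<close> lies in some \<open>U p\<close>, so
  \<open>q p\<close> would be better still.\<close>

lemma lower_semicontinuous_attains_inf:
  fixes h :: "'a::topological_space \<Rightarrow> ereal"
  assumes K: "compact K" "K \<noteq> {}" and h: "lower_semicontinuous h"
  shows "\<exists>p\<in>K. \<forall>y\<in>K. h p \<le> h y"
proof (rule ccontr)
  assume "\<not> ?thesis"
  then have "\<forall>p\<in>K. \<exists>q\<in>K. h q < h p" by (auto simp: not_le)
  then obtain q where q: "\<And>p. p \<in> K \<Longrightarrow> q p \<in> K" "\<And>p. p \<in> K \<Longrightarrow> h (q p) < h p"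
    by metis
  have "\<forall>p\<in>K. \<exists>U. open U \<and> p \<in> U \<and> (\<forall>y\<in>U. h (q p) < h y)"
    using lower_semicontinuous_eventually[OF h q(2)] by (simp add: eventually_nhds)
  then obtain U where U: "\<And>p. p \<in> K \<Longrightarrow> open (U p)" "\<And>p. p \<in> K \<Longrightarrow> p \<in> U p"
    "\<And>p y. p \<in> K \<Longrightarrow> y \<in> U p \<Longrightarrow> h (q p) < h y"
    by metis
  obtain C where C: "C \<subseteq> K" "finite C" "K \<subseteq> (\<Union>p\<in>C. U p)"
    using compactE_image[OF K(1), of K U] U by blast
  then have "C \<noteq> {}" using K(2) by auto
  then have "Min ((\<lambda>p. h (q p)) ` C) \<in> (\<lambda>p. h (q p)) ` C"
    using C(2) by (intro Min_in) auto
  then obtain p0 where p0: "p0 \<in> C" "h (q p0) = Min ((\<lambda>p. h (q p)) ` C)" by auto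
  then have le: "h (q p0) \<le> h (q p)" if "p \<in> C" for p using C(2) that by auto
  have "q p0 \<in> K" using p0 C q by auto
  then obtain p where "p \<in> C" "q p0 \<in> U p" using C(3) by auto
  then show False using le[of p] U(3)[of p "q p0"] C(1) by force
qed

section \<open>Maximal monotonicity and optimality conditions\<close>

lemma maximal_monotone_subdifferential:
  fixes R :: "'a::euclidean_space \<Rightarrow> ereal"
  assumes R: "convex_ereal R" "proper_ereal R" "lower_semicontinuous R"
    and minorant: "v0 \<in> subdifferential R z"
    and mono: "\<And>y u. u \<in> subdifferential R y \<Longrightarrow> (u - v) \<bullet> (y - x) \<ge> 0"
  shows "v \<in> subdifferential R x"
proof -
  \<comment> \<open>Minty's argument: test monotonicity at the proximal point \<open>p\<close> of \<open>x + v\<close>. The given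
    subgradient \<open>v0\<close> provides the affine minorant that makes the proximal objective coercive.\<close>
  define w where "w = x + v"
  define q where "q y = (norm (y - w))\<^sup>2 / 2" for y
  define h where "h y = ereal (q y) + R y" for y
  have R_ninf: "R y \<noteq> -\<infinity>" for y using R(2) by (auto simp: proper_ereal_def)
  have aff: "R z + ereal (v0 \<bullet> (y - z)) \<le> R y" for y
    using minorant by (auto simp: subdifferential_def)
  have "R z \<noteq> \<infinity>"
  proof
    assume "R z = \<infinity>"
    then have "R y = \<infinity>" for y using aff[of y] by simp
    then show False using R(2) by (auto simp: proper_ereal_def)
  qed
  then obtain r where r: "R z = ereal r" using R_ninf[of z] by (cases "R z") auto
  \<comment> \<open>With \<open>e = y - z\<close>, the minorant gives \<open>h y - h z\<close> the
    lower bound \<open>norm e * (norm e - \<rho>) / 2\<close>. Outside this ball \<open>h\<close> is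
    thus at least its value at the centre, and a minimiser over the ball is global.\<close>
  define \<rho> where "\<rho> = 2 * norm (z - w + v0)"
  have outside: "h z \<le> h y" if "y \<notin> cball z \<rho>" for y
  proof -
    define e where "e = y - z"
    have ne: "norm e > \<rho>" using that by (simp add: e_def dist_norm norm_minus_commute)
    have "q y = (norm e)\<^sup>2 / 2 + e \<bullet> (z - w) + q z"
    proof -
      have "y - w = e + (z - w)" by (simp add: e_def)
      moreover have "norm (e + c) ^ 2 = norm e ^ 2 + 2 * (e \<bullet> c) + norm c ^ 2" for c
        by (simp add: power2_norm_eq_inner inner_add_left inner_add_right inner_commute)
      ultimately show ?thesis
        unfolding q_def by (simp only: add_divide_distrib)
    qed
    then have "q y + v0 \<bullet> e - q z = (norm e)\<^sup>2 / 2 + e \<bullet> (z - w + v0)"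
      by (simp add: inner_add_right inner_commute)
    moreover have "\<dots> \<ge> (norm e)\<^sup>2 / 2 - norm e * norm (z - w + v0)"
      using Cauchy_Schwarz_ineq2[of e "z - w + v0"] by (simp add: abs_le_iff)
    moreover have "(norm e)\<^sup>2 / 2 - norm e * norm (z - w + v0) = norm e * (norm e - \<rho>) / 2"
      by (simp add: \<rho>_def power2_eq_square algebra_simps)
    moreover have "\<dots> \<ge> 0" using ne by (simp add: \<rho>_def)
    ultimately have "q z \<le> q y + v0 \<bullet> e" by linarith
    then have "ereal (q z) + ereal r \<le> ereal (q y) + (ereal r + ereal (v0 \<bullet> e))" by simp
    also have "\<dots> \<le> h y"
      unfolding h_def using aff[of y] r by (intro add_left_mono) (simp add: e_def)
    finally show ?thesis by (simp add: h_def r)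
  qed
  have "\<rho> \<ge> 0" by (simp add: \<rho>_def)
  moreover have "lower_semicontinuous h"
    unfolding h_def q_def using R R_ninf
    by (intro lower_semicontinuous_add_real continuous_intros) auto
  ultimately obtain p where p: "p \<in> cball z \<rho>" "\<And>y. y \<in> cball z \<rho> \<Longrightarrow> h p \<le> h y"
    using lower_semicontinuous_attains_inf[of "cball z \<rho>" h] by auto
  have min: "h p \<le> h y" for y
    using p(2)[of y] p(2)[of z] outside[of y] \<open>\<rho> \<ge> 0\<close> by fastforce
  have "R p \<noteq> \<infinity>" using min[of z] r by (auto simp: h_def)
  moreover have "GDERIV q p :> p - w"
    unfolding gderiv_def q_def power2_norm_eq_inner
    by (auto intro!: derivative_eq_intros simp: inner_commute)
  ultimately have "- (p - w) \<in> subdifferential R p"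
    using R R_ninf min unfolding h_def
    by (intro Fermat_rule_subdifferential[where f = q]) auto
  then have u: "w - p \<in> subdifferential R p" by simp
  \<comment> \<open>Here \<open>w - p - v = x - p\<close>, so the inner product is minus a squared
    norm and \<open>p = x\<close> follows.\<close>
  have "(w - p - v) \<bullet> (p - x) \<ge> 0" by (rule mono[OF u])
  moreover have "w - p - v = - (p - x)" by (simp add: w_def)
  ultimately have "0 \<le> - (p - x) \<bullet> (p - x)" by metis
  then have "(p - x) \<bullet> (p - x) \<le> 0" by (simp only: inner_minus_left neg_0_le_iff_le)
  then have "p = x" by (metis eq_iff_diff_eq_0 inner_gt_zero_iff not_le)
  then show ?thesis using u by (simp add: w_def)
qed

text \<open>One direction is Fermat's rule, where properness makes \<open>R z\<close> finite at a
  minimiser. For the other, the linear terms of the subgradient inequality for \<open>R\<close> and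
  the gradient inequality for \<open>F\<close> cancel.\<close>

lemma Argmin_iff_subdifferential:
  fixes F :: "'a::real_inner \<Rightarrow> real"
  assumes R: "convex_ereal R" "proper_ereal R"
    and F: "convex_on UNIV F" and G: "GDERIV F z :> g"
  shows "z \<in> Argmin (\<lambda>y. ereal (F y) + R y) \<longleftrightarrow> - g \<in> subdifferential R z"
proof
  assume z: "z \<in> Argmin (\<lambda>y. ereal (F y) + R y)"
  obtain y where "R y \<noteq> \<infinity>" using R by (auto simp: proper_ereal_def)
  moreover have "ereal (F z) + R z \<le> ereal (F y) + R y" using z by (auto simp: Argmin_def)
  ultimately have "R z \<noteq> \<infinity>" by (cases "R y") auto
  then show "- g \<in> subdifferential R z"
    using z R G by (intro Fermat_rule_subdifferential[where f = F])
      (auto simp: Argmin_def proper_ereal_def)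
next
  assume z: "- g \<in> subdifferential R z"
  have "ereal (F z) + R z \<le> ereal (F y) + R y" for y
  proof -
    have "R z + ereal (- g \<bullet> (y - z)) \<le> R y" using z by (auto simp: subdifferential_def)
    moreover have "F z + g \<bullet> (y - z) \<le> F y" by (rule convex_gradient_ineq[OF F G])
    ultimately show ?thesis by (cases "R z"; cases "R y") auto
  qed
  then show "z \<in> Argmin (\<lambda>y. ereal (F y) + R y)" by (auto simp: Argmin_def)
qed

section \<open>Inertial quasi-Fejer sequences\<close>

lemma le_of_square_le_affine:
  fixes D \<alpha> \<kappa> :: real
  assumes "D\<^sup>2 \<le> \<alpha> + \<kappa> * D" "0 \<le> \<alpha>" "0 \<le> \<kappa>"
  shows "D \<le> \<alpha> + \<kappa> + 1"
proof (rule ccontr)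
  assume D: "\<not> D \<le> \<alpha> + \<kappa> + 1"
  then have "(\<alpha> + \<kappa> + 1) * D \<le> D * D" using assms by (intro mult_right_mono) auto
  moreover have "\<alpha> * 1 \<le> \<alpha> * D" using D assms by (intro mult_left_mono) auto
  ultimately show False using assms D by (simp add: power2_eq_square algebra_simps)
qed

text \<open>The positive parts \<open>p\<close> of the increments of the squares obey a contraction
  of factor \<open>q < 1\<close> up to the errors \<open>t\<close>, so summing and absorbing bounds
  their sum by that of \<open>t\<close> divided by \<open>1 - q\<close>. In the application
  \<open>d\<close> is the distance to a solution and \<open>r\<close> the decrease gained per
  step.\<close>

lemma inertial_Fejer:
  fixes d e s r a :: "nat \<Rightarrow> real"
  assumes d: "\<And>k. 0 \<le> d k"
    and a: "\<And>k. 0 \<le> a k" "\<And>k. a k \<le> q" and q: "q < 1"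
    and s: "\<And>k. 0 \<le> s k" "summable s"
    and e: "\<And>k. 0 \<le> e k" "summable e"
    and r: "\<And>k. 0 \<le> r k"
    and step: "\<And>k. (d (Suc k))\<^sup>2 - (d k)\<^sup>2
      \<le> a k * ((d k)\<^sup>2 - (prev d k)\<^sup>2) + s k + e k * d (Suc k) - r k"
  shows "convergent d" and "summable r"
proof -
  define p where "p k = max 0 ((d (Suc k))\<^sup>2 - (d k)\<^sup>2)" for k
  define t where "t k = s k + e k * d (Suc k)" for k
  have p0: "0 \<le> p k" for k by (simp add: p_def)
  have t0: "0 \<le> t k" for k using s e d by (simp add: t_def)
  have q0: "0 \<le> q" using a[of 0] by simp
  \<comment> \<open>This is \<open>p\<close> delayed by one index. The value \<open>0\<close> at the
    start fits the convention \<open>prev d 0 = d 0\<close>, for which the first inertial term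
    vanishes.\<close>
  define p' where "p' k = (case k of 0 \<Rightarrow> 0 | Suc j \<Rightarrow> p j)" for k
  have p'0: "0 \<le> p' k" for k using p0 by (simp add: p'_def split: nat.splits)
  have inertia: "a k * ((d k)\<^sup>2 - (prev d k)\<^sup>2) \<le> q * p' k" for k
  proof -
    have "a k * ((d k)\<^sup>2 - (prev d k)\<^sup>2) \<le> a k * p' k"
      using a by (intro mult_left_mono) (auto simp: prev_def p'_def p_def split: nat.splits)
    also have "\<dots> \<le> q * p' k" using a p'0 by (intro mult_right_mono) auto
    finally show ?thesis .
  qed
  have p_le: "p k \<le> q * p' k + t k" for k
    using step[of k] inertia[of k] r[of k] q0 p'0[of k] t0[of k]
    by (simp add: p_def[of k] t_def)
  have sum_p': "(\<Sum>k<n. p' k) \<le> (\<Sum>k<n. p k)" for n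
  proof (cases n)
    case (Suc m)
    have "(\<Sum>k<Suc m. p' k) = (\<Sum>k<m. p k)"
      by (simp only: sum.lessThan_Suc_shift) (simp add: p'_def)
    also have "\<dots> \<le> (\<Sum>k<Suc m. p k)" using p0 by simp
    finally show ?thesis using Suc by simp
  qed simp
  have sum_p: "(\<Sum>k<n. p k) \<le> (\<Sum>k<n. t k) / (1 - q)" for n
  proof -
    have "(\<Sum>k<n. p k) \<le> (\<Sum>k<n. q * p' k + t k)" by (intro sum_mono p_le)
    also have "\<dots> = q * (\<Sum>k<n. p' k) + (\<Sum>k<n. t k)"
      by (simp add: sum.distrib sum_distrib_left)
    also have "\<dots> \<le> q * (\<Sum>k<n. p k) + (\<Sum>k<n. t k)"
      using sum_p' q0 by (intro add_right_mono mult_left_mono) auto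
    finally show ?thesis using q by (simp add: pos_le_divide_eq algebra_simps)
  qed
  have d_le: "(d n)\<^sup>2 \<le> (d 0)\<^sup>2 + (\<Sum>k<n. p k)" for n
  proof (induction n)
    case (Suc n)
    then show ?case by (simp add: p_def)
  qed simp
  define \<alpha> where "\<alpha> = (d 0)\<^sup>2 + suminf s / (1 - q)"
  define \<kappa> where "\<kappa> = suminf e / (1 - q)"
  have \<alpha>: "0 \<le> \<alpha>" and \<kappa>: "0 \<le> \<kappa>"
    using q s e by (auto simp: \<alpha>_def \<kappa>_def intro!: add_nonneg_nonneg divide_nonneg_nonneg suminf_nonneg)
  have d_bound: "d n \<le> \<alpha> + \<kappa> + 1" for n
  proof -
    \<comment> \<open>The maximum is attained at some \<open>m \<le> n\<close>, and every
      \<open>d (Suc k)\<close> with \<open>k < m\<close> is at most \<open>D\<close>. Hence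
      \<open>d_le\<close> at \<open>m\<close> becomes a quadratic inequality in \<open>D\<close>
      alone, with constants independent of \<open>n\<close>.\<close>
    define D where "D = Max (d ` {..n})"
    have le_D: "d j \<le> D" if "j \<le> n" for j using that by (auto simp: D_def)
    have "D \<in> d ` {..n}" unfolding D_def by (intro Max_in) auto
    then obtain m where m: "m \<le> n" "D = d m" by auto
    have "D \<ge> 0" using m d by simp
    have "(\<Sum>k<m. t k) \<le> (\<Sum>k<m. s k + e k * D)"
      unfolding t_def using m le_D e by (intro sum_mono add_left_mono mult_left_mono) auto
    also have "\<dots> = (\<Sum>k<m. s k) + (\<Sum>k<m. e k) * D"
      by (simp add: sum.distrib sum_distrib_right)
    also have "\<dots> \<le> suminf s + suminf e * D"
      using s e \<open>D \<ge> 0\<close> by (intro add_mono mult_right_mono sum_le_suminf) auto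
    finally have "(\<Sum>k<m. t k) / (1 - q) \<le> (suminf s + suminf e * D) / (1 - q)"
      using q by (intro divide_right_mono) auto
    then have "D\<^sup>2 \<le> \<alpha> + \<kappa> * D"
      using d_le[of m] sum_p[of m] m by (simp add: \<alpha>_def \<kappa>_def add_divide_distrib)
    then have "D \<le> \<alpha> + \<kappa> + 1" using \<alpha> \<kappa> by (rule le_of_square_le_affine)
    then show ?thesis using le_D[of n] by simp
  qed
  have "summable t"
    unfolding t_def
  proof (intro summable_add s(2))
    show "summable (\<lambda>k. e k * d (Suc k))"
      using e d d_bound
      by (intro summable_comparison_test'[OF summable_mult2[OF e(2), of "\<alpha> + \<kappa> + 1"]])
        (auto simp: abs_mult intro!: mult_left_mono)
  qed
  then have t_bound: "(\<Sum>k<n. t k) \<le> suminf t" for n using t0 by (intro sum_le_suminf) auto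
  have p_bound: "(\<Sum>k<n. p k) \<le> suminf t / (1 - q)" for n
    using sum_p[of n] divide_right_mono[OF t_bound[of n], of "1 - q"] q by simp
  then have "summable p" by (intro summableI_nonneg_bounded p0)
  then obtain P where P: "(\<lambda>n. \<Sum>k<n. p k) \<longlonglongrightarrow> P"
    by (auto simp: summable_def sums_def)
  \<comment> \<open>Subtracting the accumulated positive increments leaves only decreases, and the
    bounded partial sums keep the difference bounded below.\<close>
  have "decseq (\<lambda>n. (d n)\<^sup>2 - (\<Sum>k<n. p k))"
    by (intro decseq_SucI) (simp add: p_def)
  moreover have "- (suminf t / (1 - q)) \<le> (d n)\<^sup>2 - (\<Sum>k<n. p k)" for n
    using p_bound[of n] zero_le_power2[of "d n"] by linarith
  ultimately obtain l where "(\<lambda>n. (d n)\<^sup>2 - (\<Sum>k<n. p k)) \<longlonglongrightarrow> l"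
    using decseq_convergent by blast
  from tendsto_add[OF this P] have "(\<lambda>n. (d n)\<^sup>2) \<longlonglongrightarrow> l + P" by simp
  from tendsto_real_sqrt[OF this] show "convergent d"
    using d by (auto simp: convergent_def)
  \<comment> \<open>Telescoping \<open>step\<close> once more, now keeping the terms
    \<open>r\<close> that were dropped in \<open>p_le\<close>.\<close>
  have r_sum: "(\<Sum>k<n. r k) \<le> (d 0)\<^sup>2 - (d n)\<^sup>2 + q * (\<Sum>k<n. p' k) + (\<Sum>k<n. t k)" for n
  proof (induction n)
    case (Suc n)
    then show ?case using step[of n] inertia[of n] by (simp add: t_def[of n] algebra_simps)
  qed simp
  have "(\<Sum>k<n. r k) \<le> (d 0)\<^sup>2 + q * (suminf t / (1 - q)) + suminf t" for n
  proof -
    have "q * (\<Sum>k<n. p' k) \<le> q * (suminf t / (1 - q))"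
      using sum_p'[of n] p_bound[of n] q0 by (intro mult_left_mono) auto
    then show ?thesis using r_sum[of n] t_bound[of n] zero_le_power2[of "d n"] by linarith
  qed
  then show "summable r" by (intro summableI_nonneg_bounded r)
qed

section \<open>Estimates for a single iteration\<close>

lemma Young_norm_add:
  fixes u v :: "'a::real_inner"
  assumes "\<rho> > 0"
  shows "(norm (u + v))\<^sup>2 \<le> (1 + \<rho>) * (norm u)\<^sup>2 + (1 + 1 / \<rho>) * (norm v)\<^sup>2"
proof -
  have "0 \<le> (norm (\<rho> *\<^sub>R u - v))\<^sup>2 / \<rho>" using assms by simp
  also have "\<dots> = \<rho> * (u \<bullet> u) - 2 * (u \<bullet> v) + (v \<bullet> v) / \<rho>"
    using assms by (simp add: power2_norm_eq_inner inner_diff_left inner_diff_right inner_commute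
        field_simps)
  finally show ?thesis
    by (simp add: power2_norm_eq_inner inner_add_left inner_add_right inner_commute algebra_simps)
qed

text \<open>\<open>A\<close> and \<open>B\<close> stand for the two extrapolated points,
  \<open>w\<close> for the new iterate and \<open>g\<close> for the gradient at \<open>B\<close>
  minus that at \<open>z\<close>. The margin \<rho> in the bound on \<gamma> is spent in Young's
  inequality: \<open>(1 - \<rho>) * (1 + \<rho>)\<close> falls short of \<open>1\<close> by the
  square of \<rho>, the coefficient of the decrease.\<close>

lemma forward_backward_step:
  fixes A B w z :: "'a::real_inner"
  assumes "\<beta> > 0" "\<rho> > 0" "\<gamma> \<ge> 0" "\<gamma> \<le> 2 * \<beta> * (1 - \<rho>)" "\<epsilon> \<ge> 0"
    and coco: "\<beta> * (norm g)\<^sup>2 \<le> g \<bullet> (B - z)"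
    and incl: "(A - \<gamma> *\<^sub>R (g + \<xi>) - w) \<bullet> (w - z) \<ge> - (\<gamma> * \<epsilon>)"
  shows "(norm (w - z))\<^sup>2 \<le> (norm (A - z))\<^sup>2 - \<rho>\<^sup>2 * (norm (w - A))\<^sup>2
    + 1 / \<rho> * (norm (A - B))\<^sup>2 + 4 * \<beta> * \<epsilon> + 4 * \<beta> * norm \<xi> * norm (w - z)"
proof -
  have "2 * \<beta> * (1 - \<rho>) \<le> 2 * \<beta>" using assms by simp
  then have \<gamma>2: "\<gamma> \<le> 2 * \<beta>" using assms by linarith
  have \<rho>1: "\<rho> \<le> 1"
    using assms by (smt (verit) mult_pos_neg)
  \<comment> \<open>The square is completed so that its term in \<open>g \<bullet> g\<close> is
    exactly the one supplied by cocoercivity.\<close>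
  have "0 \<le> (norm ((2 * \<beta>) *\<^sub>R g + (w - B)))\<^sup>2 / (4 * \<beta>)" using assms by simp
  also have "\<dots> = \<beta> * (g \<bullet> g) + g \<bullet> (w - B) + (norm (w - B))\<^sup>2 / (4 * \<beta>)"
    unfolding power2_norm_eq_inner inner_add_left inner_add_right inner_scaleR_left inner_scaleR_right
    using assms by (simp add: inner_commute[of "w - B" g] field_simps)
  finally have "- ((norm (w - B))\<^sup>2 / (4 * \<beta>)) \<le> g \<bullet> (w - z)"
    using coco by (simp add: power2_norm_eq_inner inner_diff_right)
  then have "2 * \<gamma> * - ((norm (w - B))\<^sup>2 / (4 * \<beta>)) \<le> 2 * \<gamma> * (g \<bullet> (w - z))"
    using assms by (intro mult_left_mono) auto
  then have g: "- (2 * \<gamma> * (g \<bullet> (w - z))) \<le> \<gamma> / (2 * \<beta>) * (norm (w - B))\<^sup>2"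
    by simp
  have "\<gamma> / (2 * \<beta>) \<le> 1 - \<rho>" using assms by (simp add: field_simps)
  then have "\<gamma> / (2 * \<beta>) * (norm (w - B))\<^sup>2 \<le> (1 - \<rho>) * (norm (w - B))\<^sup>2"
    by (intro mult_right_mono) auto
  also have "\<dots> \<le> (1 - \<rho>) * ((1 + \<rho>) * (norm (w - A))\<^sup>2 + (1 + 1 / \<rho>) * (norm (A - B))\<^sup>2)"
    using Young_norm_add[of \<rho> "w - A" "A - B"] assms \<rho>1 by (intro mult_left_mono) auto
  also have "\<dots> = (1 - \<rho>\<^sup>2) * (norm (w - A))\<^sup>2 + (1 / \<rho> - \<rho>) * (norm (A - B))\<^sup>2"
    using assms by (simp add: field_simps power2_eq_square)
  also have "\<dots> \<le> (1 - \<rho>\<^sup>2) * (norm (w - A))\<^sup>2 + 1 / \<rho> * (norm (A - B))\<^sup>2"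
    using assms by (intro add_left_mono mult_right_mono) auto
  finally have young: "\<gamma> / (2 * \<beta>) * (norm (w - B))\<^sup>2
    \<le> (1 - \<rho>\<^sup>2) * (norm (w - A))\<^sup>2 + 1 / \<rho> * (norm (A - B))\<^sup>2" .
  have "- (\<xi> \<bullet> (w - z)) \<le> norm \<xi> * norm (w - z)"
    using Cauchy_Schwarz_ineq2[of \<xi> "w - z"] by (simp add: abs_le_iff)
  then have "2 * \<gamma> * - (\<xi> \<bullet> (w - z)) \<le> 2 * \<gamma> * (norm \<xi> * norm (w - z))"
    using assms by (intro mult_left_mono) auto
  also have "\<dots> \<le> 2 * (2 * \<beta>) * (norm \<xi> * norm (w - z))"
    using \<gamma>2 by (intro mult_right_mono mult_left_mono) auto
  finally have \<xi>: "2 * \<gamma> * - (\<xi> \<bullet> (w - z)) \<le> 4 * \<beta> * norm \<xi> * norm (w - z)" by simp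
  have \<epsilon>: "\<gamma> * \<epsilon> \<le> 2 * \<beta> * \<epsilon>" using \<gamma>2 assms by (intro mult_right_mono) auto
  have "2 * ((A - w) \<bullet> (w - z)) = (norm (A - z))\<^sup>2 - (norm (w - A))\<^sup>2 - (norm (w - z))\<^sup>2"
    by (simp add: power2_norm_eq_inner inner_diff_left inner_diff_right inner_commute)
  moreover have "(A - \<gamma> *\<^sub>R (g + \<xi>) - w) \<bullet> (w - z)
    = (A - w) \<bullet> (w - z) - \<gamma> * (g \<bullet> (w - z)) - \<gamma> * (\<xi> \<bullet> (w - z))"
    by (simp add: inner_diff_left inner_add_left algebra_simps)
  ultimately show ?thesis using incl g young \<xi> \<epsilon> by (simp add: algebra_simps)
qed

text \<open>The middle term is the source of the inertial term in
  \<open>inertial_Fejer\<close>.\<close>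

lemma norm_extrapolate_diff:
  fixes p q z :: "'a::real_inner"
  shows "(norm (p + a *\<^sub>R (p - q) - z))\<^sup>2
    = (norm (p - z))\<^sup>2 + a * ((norm (p - z))\<^sup>2 - (norm (q - z))\<^sup>2) + a * (1 + a) * (norm (p - q))\<^sup>2"
  by (simp add: power2_norm_eq_inner inner_commute algebra_simps)

lemma prev_comp: "prev (\<lambda>k. f (x k)) k = f (prev x k)"
  by (simp add: prev_def split: nat.splits)

section \<open>Convergence of the iterates\<close>

theorem proposition2p5:
  fixes R :: "real ^ 'n \<Rightarrow> ereal"
    and F :: "real ^ 'n \<Rightarrow> real"
    and G :: "real ^ 'n \<Rightarrow> real ^ 'n"
    and \<beta> a_up b_up \<epsilon>_low \<epsilon>_up :: real
    and a b \<gamma> err :: "nat \<Rightarrow> real"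
    and \<xi> x :: "nat \<Rightarrow> real ^ 'n"
  assumes "proper_ereal R" and "convex_ereal R" and "lower_semicontinuous R"
    and "\<beta> > 0"
    and "convex_on UNIV F"
    and "\<And>z. GDERIV F z :> G z"
    and "(1 / \<beta>)-lipschitz_on UNIV G"
    and "Argmin (\<lambda>z. ereal (F z) + R z) \<noteq> {}"
    and "inexact_inertial_FB \<beta> G R a_up b_up \<epsilon>_low \<epsilon>_up a b \<gamma> err \<xi> x"
    and "a_up < 1"
    and "summable (\<lambda>k. max (a k) (b k) * (norm (x k - prev x k))\<^sup>2)"
    and "((\<forall>k. a k \<in> {0<..a_up}) \<and> summable err \<and> summable (\<lambda>k. real k * norm (\<xi> k))) \<or>
         ((\<forall>k. a k = 0) \<and> summable err \<and> summable (\<lambda>k. norm (\<xi> k)))"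
  shows "\<exists>x_star \<in> Argmin (\<lambda>z. ereal (F z) + R z). x \<longlonglongrightarrow> x_star"
proof -
  note FB = assms(9)[unfolded inexact_inertial_FB_def]
  have \<epsilon>: "\<epsilon>_low > 0" "\<epsilon>_up > 0" "\<epsilon>_low \<le> 2 * \<beta> - \<epsilon>_up" and b_up: "b_up \<le> 1"
    using FB by auto
  have a: "0 \<le> a k" "a k \<le> a_up" and b: "0 \<le> b k" "b k \<le> 1"
    and \<gamma>: "\<epsilon>_low \<le> \<gamma> k" "\<gamma> k \<le> 2 * \<beta> - \<epsilon>_up" and err: "0 \<le> err k" for k
    using FB b_up by (auto intro: order_trans)
  have \<gamma>_pos: "0 < \<gamma> k" for k using \<gamma>(1)[of k] \<epsilon> by linarith
  let ?A = "extrapolate x a" and ?B = "extrapolate x b"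
  \<comment> \<open>The element of the enlargement obtained by solving the inclusion for it;
    positivity of \<open>\<gamma> k\<close> makes it unique.\<close>
  define v where "v k = (1 / \<gamma> k) *\<^sub>R (?A k - x (Suc k)) - G (?B k) - \<xi> k" for k
  have v_scaled: "\<gamma> k *\<^sub>R v k = ?A k - \<gamma> k *\<^sub>R (G (?B k) + \<xi> k) - x (Suc k)" for k
    using \<gamma>_pos[of k] by (simp add: v_def algebra_simps)
  have v: "v k \<in> enlargement (subdifferential R) (err k) (x (Suc k))" for k
  proof -
    obtain v' where v': "v' \<in> enlargement (subdifferential R) (err k) (x (Suc k))"
      "\<gamma> k *\<^sub>R v k = \<gamma> k *\<^sub>R v'"
      using FB v_scaled[of k] by auto
    then show ?thesis using \<gamma>_pos[of k] by simp
  qed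
  have "summable err" using assms(12) by auto
  have sum_\<xi>: "summable (\<lambda>k. norm (\<xi> k))"
  proof -
    \<comment> \<open>The weight \<open>real k\<close> is at least \<open>1\<close> only from index
      \<open>1\<close> on, so the comparison starts there.\<close>
    have "summable (\<lambda>k. norm (\<xi> k))" if "summable (\<lambda>k. real k * norm (\<xi> k))"
      using that
    proof (rule summable_comparison_test'[where N = 1])
      fix k :: nat assume "1 \<le> k"
      then have "1 * norm (\<xi> k) \<le> real k * norm (\<xi> k)" by (intro mult_right_mono) auto
      then show "norm (norm (\<xi> k)) \<le> real k * norm (\<xi> k)" by simp
    qed
    then show ?thesis using assms(12) by auto
  qed
  define c where "c k = max (a k) (b k)" for k
  have c: "a k \<le> c k" "b k \<le> c k" "0 \<le> c k" "c k \<le> 1" for k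
    using a[of k] b[of k] assms(10) by (auto simp: c_def)
  define \<Delta> where "\<Delta> k = x k - prev x k" for k
  have sum_\<Delta>: "summable (\<lambda>k. c k * (norm (\<Delta> k))\<^sup>2)" using assms(11) by (simp add: c_def \<Delta>_def)
  \<comment> \<open>Chosen so that the step size bound of \<open>forward_backward_step\<close> is
    exactly \<open>2 * \<beta> - \<epsilon>_up\<close>.\<close>
  define \<rho> where "\<rho> = \<epsilon>_up / (2 * \<beta>)"
  have \<rho>: "\<rho> > 0" "2 * \<beta> * (1 - \<rho>) = 2 * \<beta> - \<epsilon>_up"
    using \<epsilon> assms(4) by (auto simp: \<rho>_def field_simps)
  \<comment> \<open>The \<open>2\<close> comes from \<open>a k * (1 + a k) \<le> 2 * c k\<close>,
    the \<open>1 / \<rho>\<close> from the distance between the extrapolated points, where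
    \<open>(a k - b k)\<^sup>2 \<le> c k\<close>.\<close>
  define s where "s k = (2 + 1 / \<rho>) * (c k * (norm (\<Delta> k))\<^sup>2) + 4 * \<beta> * err k" for k
  define r where "r k = \<rho>\<^sup>2 * (norm (x (Suc k) - ?A k))\<^sup>2" for k
  have Fejer: "convergent (\<lambda>k. norm (x k - z))" "summable r"
    if z: "- G z \<in> subdifferential R z" for z
  proof -
    have step: "(norm (x (Suc k) - z))\<^sup>2 - (norm (x k - z))\<^sup>2
      \<le> a k * ((norm (x k - z))\<^sup>2 - (prev (\<lambda>k. norm (x k - z)) k)\<^sup>2) + s k
        + 4 * \<beta> * norm (\<xi> k) * norm (x (Suc k) - z) - r k" for k
    proof -
      have "(norm (x (Suc k) - z))\<^sup>2 \<le> (norm (?A k - z))\<^sup>2 - \<rho>\<^sup>2 * (norm (x (Suc k) - ?A k))\<^sup>2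
        + 1 / \<rho> * (norm (?A k - ?B k))\<^sup>2 + 4 * \<beta> * err k
        + 4 * \<beta> * norm (\<xi> k) * norm (x (Suc k) - z)"
      proof (rule forward_backward_step)
        show "\<beta> * (norm (G (?B k) - G z))\<^sup>2 \<le> (G (?B k) - G z) \<bullet> (?B k - z)"
          by (rule Baillon_Haddad[OF assms(4-7)])
        have "- err k \<le> (- G z - v k) \<bullet> (z - x (Suc k))"
          using v z unfolding enlargement_def by blast
        also have "\<dots> = (v k + G z) \<bullet> (x (Suc k) - z)"
          by (simp add: inner_diff_left inner_diff_right inner_add_left)
        finally have "\<gamma> k * - err k \<le> \<gamma> k * ((v k + G z) \<bullet> (x (Suc k) - z))"
          using \<gamma>_pos[of k] by (intro mult_left_mono) auto
        also have "\<dots> = (\<gamma> k *\<^sub>R v k + \<gamma> k *\<^sub>R G z) \<bullet> (x (Suc k) - z)"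
          by (simp add: inner_add_left distrib_left)
        also have "\<gamma> k *\<^sub>R v k + \<gamma> k *\<^sub>R G z
          = ?A k - \<gamma> k *\<^sub>R (G (?B k) - G z + \<xi> k) - x (Suc k)"
          unfolding v_scaled by (simp add: algebra_simps)
        finally show "(?A k - \<gamma> k *\<^sub>R (G (?B k) - G z + \<xi> k) - x (Suc k)) \<bullet> (x (Suc k) - z)
          \<ge> - (\<gamma> k * err k)" by simp
      qed (use \<gamma>_pos[of k] \<gamma>(2)[of k] \<rho> assms(4) err in auto)
      moreover have "(norm (?A k - z))\<^sup>2 = (norm (x k - z))\<^sup>2
        + a k * ((norm (x k - z))\<^sup>2 - (norm (prev x k - z))\<^sup>2) + a k * (1 + a k) * (norm (\<Delta> k))\<^sup>2"
        unfolding extrapolate_def \<Delta>_def by (rule norm_extrapolate_diff)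
      moreover have "a k * (1 + a k) * (norm (\<Delta> k))\<^sup>2 \<le> 2 * (c k * (norm (\<Delta> k))\<^sup>2)"
      proof -
        have "a k * (1 + a k) \<le> c k * 2" using a[of k] c[of k] by (intro mult_mono) auto
        then have "a k * (1 + a k) * (norm (\<Delta> k))\<^sup>2 \<le> c k * 2 * (norm (\<Delta> k))\<^sup>2"
          by (intro mult_right_mono) auto
        then show ?thesis by simp
      qed
      moreover have "1 / \<rho> * (norm (?A k - ?B k))\<^sup>2 \<le> 1 / \<rho> * (c k * (norm (\<Delta> k))\<^sup>2)"
      proof -
        have AB: "?A k - ?B k = (a k - b k) *\<^sub>R \<Delta> k"
          by (simp add: extrapolate_def \<Delta>_def scaleR_left_diff_distrib)
        have "\<bar>a k - b k\<bar> \<le> c k" using a[of k] b[of k] c[of k] by auto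
        then have "\<bar>a k - b k\<bar> * \<bar>a k - b k\<bar> \<le> c k * 1" using c[of k] by (intro mult_mono) auto
        then have "(a k - b k)\<^sup>2 \<le> c k" by (simp add: power2_eq_square)
        then show ?thesis using \<rho>(1) unfolding AB norm_scaleR power_mult_distrib power2_abs
          by (intro mult_left_mono mult_right_mono) auto
      qed
      ultimately show ?thesis
        unfolding prev_comp[of "\<lambda>y. norm (y - z)"] s_def r_def by (simp add: distrib_right)
    qed
    have "0 \<le> s k" for k using c[of k] \<rho> err[of k] assms(4) by (simp add: s_def)
    moreover have "summable s"
      unfolding s_def using sum_\<Delta> \<open>summable err\<close> by (intro summable_add summable_mult)
    moreover have "0 \<le> 4 * \<beta> * norm (\<xi> k)" for k using assms(4) by simp
    moreover have "summable (\<lambda>k. 4 * \<beta> * norm (\<xi> k))" using sum_\<xi> by (rule summable_mult)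
    moreover have "0 \<le> r k" for k by (simp add: r_def)
    ultimately show "convergent (\<lambda>k. norm (x k - z))" "summable r"
      using inertial_Fejer[where d = "\<lambda>k. norm (x k - z)" and a = a and q = a_up and s = s
          and e = "\<lambda>k. 4 * \<beta> * norm (\<xi> k)" and r = r] a assms(10) step by auto
  qed
  note Argmin_iff = Argmin_iff_subdifferential[OF assms(2,1,5,6)]

  \<comment> \<open>Cluster points are minimisers\<close>
  obtain z where z: "- G z \<in> subdifferential R z" using assms(8) Argmin_iff by auto
  have "bounded (range (\<lambda>k. norm (x k - z)))"
    using Fejer(1)[OF z] by (meson convergent_imp_bounded convergent_def)
  then obtain C where C: "norm (x k - z) \<le> C" for k by (auto simp: bounded_iff)
  have "bounded (range x)"
    using C by (intro boundedI[of _ "C + norm z"]) (smt (verit) norm_triangle_sub rangeE)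
  then obtain xs \<sigma> where \<sigma>: "strict_mono \<sigma>" "(x \<circ> \<sigma>) \<longlonglongrightarrow> xs"
    using bounded_imp_convergent_subsequence by blast
  have gap: "(\<lambda>k. x (Suc k) - ?A k) \<longlonglongrightarrow> 0"
  proof -
    have "(\<lambda>k. r k / \<rho>\<^sup>2) \<longlonglongrightarrow> 0 / \<rho>\<^sup>2"
      using \<rho> by (intro tendsto_divide summable_LIMSEQ_zero Fejer(2)[OF z]) auto
    then have "(\<lambda>k. (norm (x (Suc k) - ?A k))\<^sup>2) \<longlonglongrightarrow> 0" using \<rho> by (simp add: r_def)
    from tendsto_real_sqrt[OF this] show ?thesis by (simp add: tendsto_norm_zero_iff)
  qed
  \<comment> \<open>Since \<open>h k \<le> c k \<le> 1\<close>, the square of \<open>h k\<close> is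
    at most \<open>c k\<close>, so the summable series controls both extrapolations.\<close>
  have extra: "(\<lambda>k. extrapolate x h k - x k) \<longlonglongrightarrow> 0"
    if h: "\<And>k. 0 \<le> h k" "\<And>k. h k \<le> c k" for h
  proof -
    have "(\<lambda>k. (norm (h k *\<^sub>R \<Delta> k))\<^sup>2) \<longlonglongrightarrow> 0"
    proof (rule tendsto_sandwich[where f = "\<lambda>_. 0" and h = "\<lambda>k. c k * (norm (\<Delta> k))\<^sup>2"])
      have "(norm (h k *\<^sub>R \<Delta> k))\<^sup>2 \<le> c k * (norm (\<Delta> k))\<^sup>2" for k
      proof -
        have "h k * h k \<le> c k * 1" using h[of k] c[of k] by (intro mult_mono) auto
        then show ?thesis unfolding norm_scaleR power_mult_distrib power2_abs
          by (intro mult_right_mono) (auto simp: power2_eq_square)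
      qed
      then show "eventually (\<lambda>k. (norm (h k *\<^sub>R \<Delta> k))\<^sup>2 \<le> c k * (norm (\<Delta> k))\<^sup>2) sequentially"
        by simp
      show "(\<lambda>k. c k * (norm (\<Delta> k))\<^sup>2) \<longlonglongrightarrow> 0" by (rule summable_LIMSEQ_zero[OF sum_\<Delta>])
    qed auto
    from tendsto_real_sqrt[OF this] show ?thesis
      by (simp add: tendsto_norm_zero_iff extrapolate_def \<Delta>_def[symmetric] del: norm_scaleR)
  qed
  have lim_B: "(\<lambda>k. ?B (\<sigma> k)) \<longlonglongrightarrow> xs"
  proof -
    have "(\<lambda>k. ?B (\<sigma> k) - x (\<sigma> k)) \<longlonglongrightarrow> 0"
      using LIMSEQ_subseq_LIMSEQ[OF extra[OF b(1) c(2)] \<sigma>(1)] by (simp add: o_def)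
    from tendsto_add[OF this \<sigma>(2)[unfolded o_def]] show ?thesis by simp
  qed
  have lim_next: "(\<lambda>k. x (Suc (\<sigma> k))) \<longlonglongrightarrow> xs"
  proof -
    have "(\<lambda>k. (x (Suc k) - ?A k) + (?A k - x k)) \<longlonglongrightarrow> 0"
      using tendsto_add[OF gap extra[OF a(1) c(1)]] by simp
    from LIMSEQ_subseq_LIMSEQ[OF this \<sigma>(1)]
    have "(\<lambda>k. x (Suc (\<sigma> k)) - x (\<sigma> k)) \<longlonglongrightarrow> 0" by (simp add: o_def)
    from tendsto_add[OF this \<sigma>(2)[unfolded o_def]] show ?thesis by simp
  qed
  have "(\<lambda>k. (1 / \<gamma> k) *\<^sub>R (?A k - x (Suc k))) \<longlonglongrightarrow> 0"
  proof (rule Lim_null_comparison)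
    have "norm ((1 / \<gamma> k) *\<^sub>R (?A k - x (Suc k))) \<le> 1 / \<epsilon>_low * norm (x (Suc k) - ?A k)" for k
      using \<gamma>(1)[of k] \<gamma>_pos[of k] \<epsilon>(1)
      by (simp add: norm_minus_commute divide_left_mono)
    then show "eventually (\<lambda>k. norm ((1 / \<gamma> k) *\<^sub>R (?A k - x (Suc k)))
      \<le> 1 / \<epsilon>_low * norm (x (Suc k) - ?A k)) sequentially" by simp
    show "(\<lambda>k. 1 / \<epsilon>_low * norm (x (Suc k) - ?A k)) \<longlonglongrightarrow> 0"
      using gap by (intro tendsto_mult_right_zero tendsto_norm_zero)
  qed
  from LIMSEQ_subseq_LIMSEQ[OF this \<sigma>(1)]
  have lim_A: "(\<lambda>k. (1 / \<gamma> (\<sigma> k)) *\<^sub>R (?A (\<sigma> k) - x (Suc (\<sigma> k)))) \<longlonglongrightarrow> 0"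
    by (simp add: o_def)
  have lim_\<xi>: "(\<lambda>k. \<xi> (\<sigma> k)) \<longlonglongrightarrow> 0"
    using LIMSEQ_subseq_LIMSEQ[OF tendsto_norm_zero_cancel[OF summable_LIMSEQ_zero[OF sum_\<xi>]] \<sigma>(1)]
    by (simp add: o_def)
  have lim_err: "(\<lambda>k. err (\<sigma> k)) \<longlonglongrightarrow> 0"
    using LIMSEQ_subseq_LIMSEQ[OF summable_LIMSEQ_zero[OF \<open>summable err\<close>] \<sigma>(1)]
    by (simp add: o_def)
  have "continuous_on UNIV G" using assms(7) by (rule lipschitz_on_continuous_on)
  then have "isCont G xs" by (simp add: continuous_on_eq_continuous_at)
  then have lim_G: "(\<lambda>k. G (?B (\<sigma> k))) \<longlonglongrightarrow> G xs"
    using lim_B by (rule isCont_tendsto_compose)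
  have lim_v: "(\<lambda>k. v (\<sigma> k)) \<longlonglongrightarrow> - G xs"
    using tendsto_diff[OF tendsto_diff[OF lim_A lim_G] lim_\<xi>] by (simp add: v_def)
  have xs: "- G xs \<in> subdifferential R xs"
  \<comment> \<open>For fixed \<open>y\<close> and \<open>u\<close> the enlargement inequality along
    \<sigma> passes to the limit, where the enlargement parameter has vanished; \<open>z\<close>
    supplies the affine minorant.\<close>
  proof (rule maximal_monotone_subdifferential[OF assms(2,1,3) z])
    fix y u assume u: "u \<in> subdifferential R y"
    have "(\<lambda>k. (u - v (\<sigma> k)) \<bullet> (y - x (Suc (\<sigma> k))) + err (\<sigma> k))
      \<longlonglongrightarrow> (u - - G xs) \<bullet> (y - xs) + 0"
      by (intro tendsto_intros lim_v lim_next lim_err)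
    moreover have "0 \<le> (u - v (\<sigma> k)) \<bullet> (y - x (Suc (\<sigma> k))) + err (\<sigma> k)" for k
      using v[of "\<sigma> k"] u by (force simp: enlargement_def)
    ultimately have "0 \<le> (u - - G xs) \<bullet> (y - xs) + 0"
      by (intro LIMSEQ_le_const) auto
    then show "0 \<le> (u - - G xs) \<bullet> (y - xs)" by simp
  qed
  \<comment> \<open>Opial's argument: \<open>xs\<close> is now known to be a solution, so the whole
    sequence of distances to it converges, and the subsequence identifies the limit as
    \<open>0\<close>.\<close>
  obtain l where l: "(\<lambda>k. norm (x k - xs)) \<longlonglongrightarrow> l"
    using Fejer(1)[OF xs] by (auto simp: convergent_def)
  have "(\<lambda>k. norm (x (\<sigma> k) - xs)) \<longlonglongrightarrow> norm (xs - xs)"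
    using \<sigma>(2) by (intro tendsto_intros) (simp add: o_def)
  moreover have "(\<lambda>k. norm (x (\<sigma> k) - xs)) \<longlonglongrightarrow> l"
    using LIMSEQ_subseq_LIMSEQ[OF l \<sigma>(1)] by (simp add: o_def)
  ultimately have "l = 0" using LIMSEQ_unique by fastforce
  then have "x \<longlonglongrightarrow> xs" using l by (simp add: tendsto_norm_zero_iff LIM_zero_iff)
  then show ?thesis using xs Argmin_iff by blast
qed

end
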